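(* If the Riemann Hypothesis is false, then there is $\psi\in L^{2}(0,1)$ such that $\psi\in \text{RevHölder}\left(L^{2}(0,1),L^{\infty}(0,1)\right)$ and $$\int_{0}^{1}\psi(x)\,\rho\left(\frac{1}{ax}\right)dx=0\quad\text{for all real } a\geq 1.$$
   Context: $\rho(t)=t-\lfloor t\rfloor$ denotes the fractional part of $t$. The Riemann Hypothesis is the statement that the Riemann zeta function $\zeta(s)$ has no zeros with $\frac12<\operatorname{Re}(s)<1$. For $\psi\in L^2(0,1)$ and $t>0$, the $K$-functional is $K(t,\psi,L^2,L^\infty)=\inf\{\Vert \psi_0\Vert_{L^2(0,1)}+t\Vert \psi_1\Vert_{L^\infty(0,1)}:\psi=\psi_0+\psi_1,\ \psi_0\in L^2(0,1),\ \psi_1\in L^\infty(0,1)\}$. The abstract reverse Hölder class $\text{RevHölder}(L^2(0,1),L^\infty(0,1))$ is described through its index characterization: a nonzero $\psi\in L^2(0,1)$ belongs to it if and only if the index of $K(\cdot,\psi,L^2,L^\infty)$ is positive, i.e. there are $\theta\in(0,1]$ and $\gamma>0$ such that $$\frac{K(s,\psi,L^2,L^\infty)}{K(t,\psi,L^2,L^\infty)}\leq\gamma\left(\frac{s}{t}\right)^{\theta}\quad\text{for all } 0<s<t\leq 1$$ (equivalently, $s^{-\theta}K(s,\psi,L^2,L^\infty)$ is almost increasing on $(0,1]$ for some $\theta>0$). Only nonzero $\psi$ are considered as members of the class. *)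

theory Defs
  imports "HOL-Complex_Analysis.Complex_Analysis" "HOL-Probability.Essential_Supremum"
begin

text \<open>
  The Riemann zeta function: the value at \<open>s\<close> of the holomorphic continuation of the
  Dirichlet series to a half-plane \<open>Re z > c\<close> containing \<open>s\<close>, punctured at the pole 1.
  A half-plane punctured at one point is connected, so by the identity theorem the value does
  not depend on \<open>c\<close>; letting \<open>c\<close> vary covers the whole plane except \<open>s = 1\<close>, where the value
  is unspecified.
\<close>

definition zeta :: "complex \<Rightarrow> complex" where
  "zeta s = (THE w. \<exists>c f. c < Re s \<and>
     f holomorphic_on ({z. c < Re z} - {1}) \<and>
     (\<forall>z. 1 < Re z \<longrightarrow> f z = (\<Sum>n. 1 / of_nat (Suc n) powr z)) \<and>
     w = f s)"

definition Riemann_Hypothesis :: bool where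
  "Riemann_Hypothesis \<longleftrightarrow> (\<forall>s. 1/2 < Re s \<and> Re s < 1 \<longrightarrow> zeta s \<noteq> 0)"

abbreviation unit_interval_measure :: "real measure" where
  "unit_interval_measure \<equiv> lebesgue_on {0<..<1}"

text \<open>
  Elements of the Lebesgue spaces are represented by real-valued functions; equality in these
  spaces is equality almost everywhere.
\<close>

definition L2 :: "(real \<Rightarrow> real) set" where
  "L2 = {f \<in> borel_measurable unit_interval_measure.
           integrable unit_interval_measure (\<lambda>x. (f x)\<^sup>2)}"

definition L2_norm :: "(real \<Rightarrow> real) \<Rightarrow> real" where
  "L2_norm f = sqrt (LINT x|unit_interval_measure. (f x)\<^sup>2)"

definition Linf :: "(real \<Rightarrow> real) set" where
  "Linf = {f \<in> borel_measurable unit_interval_measure.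
             esssup unit_interval_measure (\<lambda>x. ereal \<bar>f x\<bar>) < \<infinity>}"

definition Linf_norm :: "(real \<Rightarrow> real) \<Rightarrow> real" where
  "Linf_norm f = real_of_ereal (esssup unit_interval_measure (\<lambda>x. ereal \<bar>f x\<bar>))"

definition K_functional :: "real \<Rightarrow> (real \<Rightarrow> real) \<Rightarrow> real" where
  "K_functional t \<psi> = Inf {L2_norm \<psi>0 + t * Linf_norm \<psi>1 | \<psi>0 \<psi>1.
     \<psi>0 \<in> L2 \<and> \<psi>1 \<in> Linf \<and> (AE x in unit_interval_measure. \<psi> x = \<psi>0 x + \<psi>1 x)}"

definition RevHolder_L2_Linf :: "(real \<Rightarrow> real) set" where
  "RevHolder_L2_Linf = {\<psi> \<in> L2. \<not> (AE x in unit_interval_measure. \<psi> x = 0) \<and>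
     (\<exists>\<theta> \<gamma>. 0 < \<theta> \<and> \<theta> \<le> 1 \<and> 0 < \<gamma> \<and>
       (\<forall>s t. 0 < s \<and> s < t \<and> t \<le> 1 \<longrightarrow>
          K_functional s \<psi> / K_functional t \<psi> \<le> \<gamma> * (s / t) powr \<theta>))}"

end

(* For Re s > 0 and 0 < \<theta> \<le> 1, integrating over the pieces \<theta>/(n+1) \<le> x \<le> \<theta>/n gives
     int_0^1 x^(s-1) frac(\<theta>/x) dx = \<theta>/(s-1) - \<theta>^s zeta(s)/s.
   At a zero s this equals \<theta>/(s-1), and multiplication by s - 1 makes it real, so that
   \<psi>(x) = Im ((s-1) x^(s-1)) is orthogonal to all frac(\<theta>/x).  The zero is not real because the
   integral is nonnegative for real s while 1/(s-1) < 0 for 0 < s < 1, so \<psi> does not vanish.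
   Finally, K(t, \<psi>) is comparable to the L2 norm of \<psi> on (0, t^2), and hence to t^(2 Re s - 1). *)

theory Submission
  imports Defs
begin

text \<open>The assumption Re s > 1/2 enters twice: it puts x^(s-1) into L^2(0,1), and it makes the
  exponent 2 Re s - 1 of the K-functional positive. The condition a >= 1 becomes \<theta> = 1/a <=
  1, where the integral formula is clean because the floor of \<theta>/x is 0 on (\<theta>, 1].

  Zeta is given only as the common value of all analytic continuations, so a continuation has to be
  supplied. The integral formula does this itself: its case \<theta> = 1, solved for zeta, is one.

  The scale t^2 balances the two norms: a function bounded by M has L^2 norm at most t M on (0,
  t^2), while above t^2 the modulus of \<psi> is at most |s-1| t^(2 Re s - 2), which the weight t
  turns into the order t^(2 Re s - 1) again. The delicate side is the lower bound: \<psi> is x^(Re s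
  - 1) times a sine of Im s log x plus a phase, with zeros accumulating at 0, so no pointwise lower
  bound exists. Its square is therefore integrated exactly.\<close>

section \<open>Complex powers on the unit interval\<close>

lemma powr_has_vector_derivative:
  fixes s :: complex
  assumes "x > 0"
  shows "((\<lambda>x. of_real x powr s) has_vector_derivative s * of_real x powr (s - 1)) (at x within A)"
proof -
  have "complex_of_real x \<notin> \<real>\<^sub>\<le>\<^sub>0"
    using assms by (auto elim!: nonpos_Reals_cases)
  then show ?thesis
    by (intro has_vector_derivative_real_field has_field_derivative_powr)
qed

lemma has_integral_powr_from_0_complex:
  fixes s :: complex
  assumes "Re s > 0" "h \<ge> 0"
  shows "((\<lambda>x. of_real x powr (s - 1)) has_integral of_real h powr s / s) {0..h}"
proof -
  have "s \<noteq> 0" using assms by auto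
  have "((\<lambda>x. of_real x powr (s - 1)) has_integral
          (of_real h powr s / s - of_real 0 powr s / s)) {0..h}"
  proof (rule fundamental_theorem_of_calculus_interior)
    show "continuous_on {0..h} (\<lambda>x. of_real x powr s / s)"
      using assms by (auto intro!: continuous_intros)
    fix x :: real assume "x \<in> {0<..<h}"
    then have "((\<lambda>x. of_real x powr s / s) has_vector_derivative
                (s * of_real x powr (s - 1)) / s) (at x)"
      by (intro has_vector_derivative_divide powr_has_vector_derivative) auto
    then show "((\<lambda>x. of_real x powr s / s) has_vector_derivative of_real x powr (s - 1)) (at x)"
      using \<open>s \<noteq> 0\<close> by simp
  qed fact
  then show ?thesis by simp
qed

lemma has_integral_powr_from_0_real:
  fixes a :: real
  assumes "a > 0" "h \<ge> 0"
  shows "((\<lambda>x. x powr (a - 1)) has_integral h powr a / a) {0..h}"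
  using has_integral_powr_from_0[of "a - 1" h] assms by simp

text \<open>The fractional part lies in [0, 1), so x^(Re s - 1) dominates. Absolute integrability
  lets values computed by antiderivatives be transferred to the Lebesgue integral.\<close>

lemma absolutely_integrable_powr_frac:
  fixes s :: complex
  assumes "Re s > 0"
  shows "(\<lambda>x. of_real x powr (s - 1) * of_real (frac (\<theta> / x))) absolutely_integrable_on {0<..<1}"
proof (rule measurable_bounded_by_integrable_imp_absolutely_integrable)
  have "(\<lambda>x. complex_of_real x powr (s - 1)) \<in> borel_measurable (lebesgue_on {0<..<1})"
    by (intro continuous_imp_measurable_on_sets_lebesgue continuous_intros) auto
  moreover have "(\<lambda>x::real. frac (\<theta> / x)) \<in> borel_measurable (lebesgue_on {0<..<1})"
    unfolding frac_def by (intro measurable_restrict_space1 measurable_completion) measurable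
  ultimately show "(\<lambda>x. complex_of_real x powr (s - 1) * of_real (frac (\<theta> / x)))
      \<in> borel_measurable (lebesgue_on {0<..<1})"
    by measurable
  show "(\<lambda>x. x powr (Re s - 1)) integrable_on {0<..<1}"
    using has_integral_powr_from_0_real[of "Re s" 1] assms
    by (auto simp: integrable_on_def has_integral_Icc_iff_Ioo)
  fix x :: real assume "x \<in> {0<..<1}"
  then show "norm (of_real x powr (s - 1) * complex_of_real (frac (\<theta> / x))) \<le> x powr (Re s - 1)"
    by (auto simp: norm_mult norm_powr_real_powr frac_ge_0 abs_of_nonneg less_imp_le[OF frac_lt_1] mult_left_le)
qed auto

text \<open>
  The first two terms of the Euler-Maclaurin formula; they converge to \<open>zeta s\<close> for \<open>Re s > 0\<close>.
\<close>

definition zeta_partial :: "nat \<Rightarrow> complex \<Rightarrow> complex" where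
  "zeta_partial N s = (\<Sum>n<N. 1 / of_nat (Suc n) powr s) + of_nat N powr (1 - s) / (s - 1)"

section \<open>Exact evaluation of the fractional-part integral away from 0\<close>

text \<open>Inside the interval the floor of \<theta>/x is k, so the integrand is \<theta> x^(s-2) -
  k x^(s-1), with an elementary antiderivative. Bounds on \<open>\<theta> / b\<close> and
  \<open>\<theta> / a\<close> instead of fixed endpoints let k = 0 cover [\<theta>, 1], where
  \<theta>/k would make no sense.\<close>

lemma has_integral_powr_frac_piece:
  fixes s :: complex
  assumes s: "s \<noteq> 0" "s \<noteq> 1" and \<theta>: "0 < a" "a \<le> b" and "\<theta> / b \<ge> real k" "\<theta> / a \<le> real k + 1"
  shows "((\<lambda>x. of_real x powr (s - 1) * of_real (frac (\<theta> / x))) has_integral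
           of_real \<theta> * (of_real b powr (s - 1) - of_real a powr (s - 1)) / (s - 1)
           - of_nat k * (of_real b powr s - of_real a powr s) / s) {a..b}"
proof (rule has_integral_spike_finite)
  define F where "F = (\<lambda>x. of_real \<theta> * of_real x powr (s - 1) / (s - 1) - of_nat k * of_real x powr s / s)"
  define G where "G = (\<lambda>x. of_real x powr (s - 1) * complex_of_real (\<theta> / x - real k))"
  have "(F has_vector_derivative G x) (at x within {a..b})" if "x \<in> {a..b}" for x
  proof -
    have x: "x > 0" using that \<theta> by auto
    then have p: "of_real x powr (s - 1 - 1) = of_real x powr (s - 1) / complex_of_real x"
      by (subst powr_diff) auto
    have "(F has_vector_derivative of_real \<theta> * ((s - 1) * of_real x powr (s - 1 - 1)) / (s - 1)
             - of_nat k * (s * of_real x powr (s - 1)) / s) (at x within {a..b})"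
      unfolding F_def
      by (intro has_vector_derivative_diff has_vector_derivative_divide
          has_vector_derivative_mult_right powr_has_vector_derivative x)
    also have "of_real \<theta> * ((s - 1) * of_real x powr (s - 1 - 1)) / (s - 1)
             - of_nat k * (s * of_real x powr (s - 1)) / s = G x"
      using s x unfolding G_def p by (simp add: field_simps)
    finally show ?thesis .
  qed
  then have "(G has_integral F b - F a) {a..b}"
    by (intro fundamental_theorem_of_calculus) (use \<theta> in auto)
  also have "F b - F a = of_real \<theta> * (of_real b powr (s - 1) - of_real a powr (s - 1)) / (s - 1)
           - of_nat k * (of_real b powr s - of_real a powr s) / s"
    unfolding F_def by (simp add: right_diff_distrib diff_divide_distrib)
  finally show "(G has_integral \<dots>) {a..b}" .
  \<comment> \<open>If \<theta>/a = k + 1, the floor at x = a is k + 1 and not k; the endpoints are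
    therefore dropped.\<close>
  show "of_real x powr (s - 1) * of_real (frac (\<theta> / x)) = G x" if "x \<in> {a..b} - {a, b}" for x
  proof -
    have x: "a < x" "x < b" using that by auto
    have "real k * b \<le> \<theta>" "\<theta> \<le> (real k + 1) * a" using assms by (auto simp: field_simps)
    moreover have "real k * x \<le> real k * b" "(real k + 1) * a < (real k + 1) * x"
      using x by (auto intro!: mult_left_mono mult_strict_left_mono)
    ultimately have "real k \<le> \<theta> / x" "\<theta> / x < real k + 1"
      using x \<theta> by (auto simp: field_simps)
    then have "\<lfloor>\<theta> / x\<rfloor> = int k" by linarith
    then show ?thesis by (simp add: G_def frac_def)
  qed
qed auto

text \<open>Each new piece [\<theta>/(N+1), \<theta>/N] changes the integral by exactly the
  increment of \<open>zeta_partial\<close>, scaled by -\<theta>^s / s. The induction starts at N = 1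
  with the piece k = 0, matching 1 + 1/(s-1) = s/(s-1).\<close>

lemma has_integral_powr_frac_truncated:
  fixes s :: complex
  assumes s: "s \<noteq> 0" "s \<noteq> 1" and \<theta>: "0 < \<theta>" "\<theta> \<le> 1" and "N \<ge> 1"
  shows "((\<lambda>x. of_real x powr (s - 1) * of_real (frac (\<theta> / x))) has_integral
           of_real \<theta> / (s - 1) - of_real \<theta> powr s * zeta_partial N s / s) {\<theta> / real N..1}"
  using \<open>N \<ge> 1\<close>
proof (induction N rule: dec_induct)
  case base
  have p: "of_real \<theta> powr (s - 1) = of_real \<theta> powr s / complex_of_real \<theta>"
    using \<theta> by (subst powr_diff) auto
  have "((\<lambda>x. of_real x powr (s - 1) * of_real (frac (\<theta> / x))) has_integral
           of_real \<theta> * (of_real 1 powr (s - 1) - of_real \<theta> powr (s - 1)) / (s - 1)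
           - of_nat 0 * (of_real 1 powr s - of_real \<theta> powr s) / s) {\<theta>..1}"
    using s \<theta> by (intro has_integral_powr_frac_piece) auto
  also have "of_real \<theta> * (of_real 1 powr (s - 1) - of_real \<theta> powr (s - 1)) / (s - 1)
           - of_nat 0 * (of_real 1 powr s - of_real \<theta> powr s) / s
      = (of_real \<theta> - of_real \<theta> powr s) / (s - 1)"
    using \<theta> by (simp add: p right_diff_distrib)
  also have "zeta_partial 1 s = s / (s - 1)"
    using s by (simp add: zeta_partial_def field_simps)
  then have "(of_real \<theta> - of_real \<theta> powr s) / (s - 1)
      = of_real \<theta> / (s - 1) - of_real \<theta> powr s * zeta_partial 1 s / s"
    using s by (simp add: diff_divide_distrib)
  finally show ?case by simp
next
  case (step N)
  define p where "p = of_real \<theta> powr s"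
  define u where "u = of_nat N powr s"
  define v where "v = of_nat (Suc N) powr s"
  have nz: "u \<noteq> 0" "v \<noteq> 0" "p \<noteq> 0" "complex_of_nat N \<noteq> 0" "complex_of_nat (Suc N) \<noteq> 0"
      "complex_of_real \<theta> \<noteq> 0" "s - 1 \<noteq> 0"
    using step \<theta> s unfolding u_def v_def p_def by (auto simp: powr_def simp del: of_nat_Suc)
  \<comment> \<open>The power of the product splits without a branch correction because both factors
    are nonnegative reals.\<close>
  have pw: "of_real (\<theta> / real M) powr s = p / of_nat M powr s" if "M > 0" for M
  proof -
    have "complex_of_real \<theta> = of_real (\<theta> / real M) * of_nat M" using that by simp
    then have "p = (of_real (\<theta> / real M) * of_nat M) powr s" unfolding p_def by simp
    also have "\<dots> = of_real (\<theta> / real M) powr s * of_nat M powr s"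
      using \<theta> by (intro powr_times_real) auto
    finally show ?thesis using that by (simp add: powr_def)
  qed
  have pw1: "of_real (\<theta> / real M) powr (s - 1) = (p / of_nat M powr s) / (of_real \<theta> / of_nat M)"
    if "M > 0" for M
    using that \<theta> by (subst powr_diff, subst pw) auto
  have A: "of_real (\<theta> / real N) powr s = p / u" "of_real (\<theta> / real (Suc N)) powr s = p / v"
    using pw[of N] pw[of "Suc N"] step by (simp_all add: u_def v_def del: of_nat_Suc)
  have B: "of_real (\<theta> / real N) powr (s - 1) = (p / u) / (of_real \<theta> / of_nat N)"
          "of_real (\<theta> / real (Suc N)) powr (s - 1) = (p / v) / (of_real \<theta> / of_nat (Suc N))"
    using pw1[of N] pw1[of "Suc N"] step by (simp_all add: u_def v_def del: of_nat_Suc)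
  have w1: "of_nat M powr (1 - s) = of_nat M / of_nat M powr s" if "M > 0" for M
    using that by (subst powr_diff) auto
  have "((\<lambda>x. of_real x powr (s - 1) * of_real (frac (\<theta> / x))) has_integral
     (of_real \<theta> * (of_real (\<theta> / real N) powr (s - 1) - of_real (\<theta> / real (Suc N)) powr (s - 1)) / (s - 1)
           - of_nat N * (of_real (\<theta> / real N) powr s - of_real (\<theta> / real (Suc N)) powr s) / s) +
     (of_real \<theta> / (s - 1) - of_real \<theta> powr s * zeta_partial N s / s)) {\<theta> / real (Suc N)..1}"
    by (rule has_integral_combine[OF _ _ has_integral_powr_frac_piece step.IH])
       (use s \<theta> step in \<open>auto simp: field_simps\<close>)
  also have "(of_real \<theta> * (of_real (\<theta> / real N) powr (s - 1) - of_real (\<theta> / real (Suc N)) powr (s - 1)) / (s - 1)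
           - of_nat N * (of_real (\<theta> / real N) powr s - of_real (\<theta> / real (Suc N)) powr s) / s)
      = p * ((of_nat N / u - of_nat (Suc N) / v) / (s - 1) - of_nat N * (1 / u - 1 / v) / s)"
    unfolding A B using nz by (simp add: diff_divide_distrib right_diff_distrib mult.commute del: of_nat_Suc)
  also have "\<dots> = p * (zeta_partial N s - zeta_partial (Suc N) s) / s"
  proof -
    define K where "K = complex_of_nat N"
    have "zeta_partial N s - zeta_partial (Suc N) s
        = (K / u) / (s - 1) - 1 / v - ((K + 1) / v) / (s - 1)"
      using w1[of N] w1[of "Suc N"] step
      unfolding u_def[symmetric] v_def[symmetric] zeta_partial_def K_def by (simp add: v_def add.commute)
    \<comment> \<open>A rational identity resting on 1/(s-1) - 1/s = 1/(s(s-1)); it makes the sum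
      telescope.\<close>
    moreover have "(K / u - (K + 1) / v) / (s - 1) - K * (1 / u - 1 / v) / s
        = ((K / u) / (s - 1) - 1 / v - ((K + 1) / v) / (s - 1)) / s"
      using nz s by (simp add: divide_simps) (simp add: algebra_simps)
    ultimately show ?thesis by (simp add: K_def add.commute)
  qed
  also have "p * (zeta_partial N s - zeta_partial (Suc N) s) / s +
       (of_real \<theta> / (s - 1) - of_real \<theta> powr s * zeta_partial N s / s)
     = of_real \<theta> / (s - 1) - of_real \<theta> powr s * zeta_partial (Suc N) s / s"
    unfolding p_def[symmetric] by (simp add: diff_divide_distrib right_diff_distrib)
  finally show ?case .
qed

text \<open>The error is the integral over the omitted stretch [0, \<theta>/N], where x^(Re s - 1)
  bounds the integrand.\<close>

lemma powr_frac_integral_approx: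
  fixes s :: complex
  assumes s: "Re s > 0" "s \<noteq> 1" and \<theta>: "0 < \<theta>" "\<theta> \<le> 1" and N: "N \<ge> 1"
  shows "norm (integral {0..1} (\<lambda>x. of_real x powr (s - 1) * of_real (frac (\<theta> / x)))
             - (of_real \<theta> / (s - 1) - of_real \<theta> powr s * zeta_partial N s / s))
         \<le> (\<theta> / real N) powr Re s / Re s"
proof -
  define g where "g = (\<lambda>x. of_real x powr (s - 1) * complex_of_real (frac (\<theta> / x)))"
  have "s \<noteq> 0" using s by auto
  have N': "0 < \<theta> / real N" "\<theta> / real N \<le> 1" using N \<theta> by (auto simp: field_simps)
  have int: "g integrable_on {0..1}"
    using absolutely_integrable_powr_frac[OF s(1), of \<theta>]
    unfolding g_def absolutely_integrable_on_def by (simp add: integrable_on_Icc_iff_Ioo)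
  have A: "integral {\<theta> / real N..1} g = of_real \<theta> / (s - 1) - of_real \<theta> powr s * zeta_partial N s / s"
    unfolding g_def
    by (rule integral_unique[OF has_integral_powr_frac_truncated]) (use s \<open>s \<noteq> 0\<close> \<theta> N in auto)
  have B: "integral {0..\<theta> / real N} g + integral {\<theta> / real N..1} g = integral {0..1} g"
    by (rule Henstock_Kurzweil_Integration.integral_combine) (use N' int in auto)
  have "norm (integral {0..\<theta> / real N} g) \<le> (\<theta> / real N) powr Re s / Re s"
  proof -
    note h = has_integral_powr_from_0_real[of "Re s" "\<theta> / real N"]
    have "norm (integral {0..\<theta> / real N} g) \<le> integral {0..\<theta> / real N} (\<lambda>x. x powr (Re s - 1))"
    proof (rule Henstock_Kurzweil_Integration.integral_norm_bound_integral)
      show "g integrable_on {0..\<theta> / real N}"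
        by (rule integrable_on_subinterval[OF int]) (use N' in auto)
      show "(\<lambda>x. x powr (Re s - 1)) integrable_on {0..\<theta> / real N}"
        using h s N' by (auto simp: integrable_on_def)
      show "norm (g x) \<le> x powr (Re s - 1)" if "x \<in> {0..\<theta> / real N}" for x
        using that unfolding g_def
        by (auto simp: norm_mult norm_powr_real_powr frac_ge_0 abs_of_nonneg
            less_imp_le[OF frac_lt_1] mult_left_le)
    qed
    then show ?thesis using integral_unique[OF h] s N' by simp
  qed
  then show ?thesis
    unfolding g_def[symmetric] A[symmetric] B[symmetric] by simp
qed

section \<open>Analytic continuation of zeta to Re s > 0\<close>

text \<open>The substitution u = 1/x gives the classical s/(s-1) - s times the integral of frac(u)
  u^(-s-1) over u >= 1.\<close>

definition zeta_cont :: "complex \<Rightarrow> complex" where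
  "zeta_cont s = s / (s - 1) - s * integral {0..1} (\<lambda>x. of_real x powr (s - 1) * of_real (frac (1 / x)))"

lemma zeta_partial_approx:
  assumes s: "Re s > 0" "s \<noteq> 1" and N: "N \<ge> 1"
  shows "norm (zeta_partial N s - zeta_cont s) \<le> norm s * real N powr (- Re s) / Re s"
proof -
  let ?I = "integral {0..1} (\<lambda>x. of_real x powr (s - 1) * complex_of_real (frac (1 / x)))"
  have "s \<noteq> 0" using s by auto
  then have "zeta_partial N s - zeta_cont s = s * (?I - (1 / (s - 1) - zeta_partial N s / s))"
    by (simp add: zeta_cont_def algebra_simps)
  also have "norm \<dots> \<le> norm s * ((1 / real N) powr Re s / Re s)"
    using mult_left_mono[OF powr_frac_integral_approx[OF s, of 1 N], of "norm s"] N
    by (simp add: norm_mult)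
  also have "\<dots> = norm s * real N powr (- Re s) / Re s"
    by (simp add: powr_minus inverse_powr inverse_eq_divide[symmetric])
  finally show ?thesis .
qed

text \<open>The error bound has no factor 1/(s-1), so uniformity asks for no distance from the pole,
  only for a bound on |s| and a positive lower bound on Re s.\<close>

lemma uniform_limit_zeta_partial:
  assumes "\<delta> > 0" "bounded S" "1 \<notin> S" "\<And>s. s \<in> S \<Longrightarrow> \<delta> \<le> Re s"
  shows "uniform_limit S zeta_partial zeta_cont sequentially"
proof -
  obtain M where M: "\<And>s. s \<in> S \<Longrightarrow> norm s \<le> M" and "M > 0"
    using \<open>bounded S\<close> by (auto simp: bounded_pos)
  have lim: "(\<lambda>N. M * real N powr (- \<delta>) / \<delta>) \<longlonglongrightarrow> M * 0 / \<delta>"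
    using \<open>\<delta> > 0\<close>
    by (intro tendsto_intros tendsto_neg_powr filterlim_real_sequentially) auto
  show ?thesis
  proof (rule uniform_limitI)
    fix e :: real assume "e > 0"
    then have "\<forall>\<^sub>F N in sequentially. M * real N powr (- \<delta>) / \<delta> < e"
      using order_tendstoD(2)[OF lim, of e] by simp
    moreover have "\<forall>\<^sub>F N in sequentially. N \<ge> (1::nat)" by (rule eventually_ge_at_top)
    ultimately show "\<forall>\<^sub>F N in sequentially. \<forall>s\<in>S. dist (zeta_partial N s) (zeta_cont s) < e"
    proof eventually_elim
      case (elim N)
      show ?case
      proof
        fix s assume s: "s \<in> S"
        then have Re: "\<delta> \<le> Re s" by (rule assms)
        have "norm (zeta_partial N s - zeta_cont s) \<le> norm s * real N powr (- Re s) / Re s"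
          by (rule zeta_partial_approx) (use s assms(1,3) Re elim in auto)
        also have "\<dots> \<le> M * real N powr (- \<delta>) / \<delta>"
          using Re \<open>\<delta> > 0\<close> \<open>M > 0\<close> M[OF s] elim
          by (intro frac_le mult_mono powr_mono) auto
        finally show "dist (zeta_partial N s) (zeta_cont s) < e"
          using elim by (simp add: dist_norm)
      qed
    qed
  qed
qed

lemma open_Re_gt_delete: "open ({z. c < Re z} - {a})"
  by (intro open_Diff open_halfspace_Re_gt) auto

text \<open>Holomorphy comes from the locally uniform convergence of the elementary functions
  \<open>zeta_partial N\<close>, which avoids differentiation under the integral.\<close>

lemma zeta_cont_holomorphic: "zeta_cont holomorphic_on ({z. 0 < Re z} - {1})"
proof (rule holomorphic_uniform_sequence[OF open_Re_gt_delete])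
  show "zeta_partial N holomorphic_on ({z. 0 < Re z} - {1})" for N
    unfolding zeta_partial_def [abs_def] by (intro holomorphic_intros) (auto simp: powr_def)
  fix x :: complex assume x: "x \<in> {z. 0 < Re z} - {1}"
  then obtain e where e: "e > 0" "cball x e \<subseteq> {z. 0 < Re z} - {1}"
    using open_Re_gt_delete open_contains_cball by blast
  \<comment> \<open>The radius Re x / 2 keeps real parts on the ball above Re x / 2, as uniformity
    requires.\<close>
  define d where "d = min e (Re x / 2)"
  have d: "d > 0" "cball x d \<subseteq> {z. 0 < Re z} - {1}"
    using e x by (auto simp: d_def)
  have "Re x / 2 \<le> Re s" if "s \<in> cball x d" for s
    using that abs_Re_le_cmod[of "x - s"] by (auto simp: dist_norm d_def)
  then have "uniform_limit (cball x d) zeta_partial zeta_cont sequentially"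
    using d x by (intro uniform_limit_zeta_partial[of "Re x / 2"]) auto
  with d show "\<exists>d>0. cball x d \<subseteq> {z. 0 < Re z} - {1} \<and>
      uniform_limit (cball x d) zeta_partial zeta_cont sequentially"
    by blast
qed

lemma zeta_partial_tendsto:
  assumes "Re s > 0" "s \<noteq> 1"
  shows "(\<lambda>N. zeta_partial N s) \<longlonglongrightarrow> zeta_cont s"
  using uniform_limit_zeta_partial[of "Re s" "{s}"] assms by (auto simp: tendsto_uniform_limitI)

text \<open>For Re s > 1 the correction term N^(1-s)/(s-1) tends to 0, leaving the partial sums of
  the Dirichlet series.\<close>

lemma zeta_cont_eq_suminf:
  assumes "Re s > 1"
  shows "zeta_cont s = (\<Sum>n. 1 / of_nat (Suc n) powr s)"
proof -
  have "(\<lambda>N. of_nat N powr (1 - s) / (s - 1)) \<longlonglongrightarrow> 0 / (s - 1)"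
    using assms
    by (intro tendsto_divide tendsto_const tendsto_neg_powr_complex_of_nat filterlim_ident) auto
  moreover have "(\<lambda>N. zeta_partial N s) \<longlonglongrightarrow> zeta_cont s"
    using assms by (intro zeta_partial_tendsto) auto
  ultimately have "(\<lambda>N. zeta_partial N s - of_nat N powr (1 - s) / (s - 1)) \<longlonglongrightarrow> zeta_cont s - 0 / (s - 1)"
    by (intro tendsto_diff)
  then show ?thesis
    by (intro sums_unique) (simp add: zeta_partial_def sums_def)
qed

lemma zeta_eq_zeta_cont:
  assumes "Re s > 0" "s \<noteq> 1"
  shows "zeta s = zeta_cont s"
  unfolding zeta_def
proof (rule the_equality)
  show "\<exists>c f. c < Re s \<and> f holomorphic_on {z. c < Re z} - {1} \<and>
     (\<forall>z. 1 < Re z \<longrightarrow> f z = (\<Sum>n. 1 / of_nat (Suc n) powr z)) \<and> zeta_cont s = f s"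
    using zeta_cont_holomorphic zeta_cont_eq_suminf assms
    by (intro exI[of _ 0] exI[of _ zeta_cont]) auto
next
  fix w
  assume "\<exists>c f. c < Re s \<and> f holomorphic_on {z. c < Re z} - {1} \<and>
     (\<forall>z. 1 < Re z \<longrightarrow> f z = (\<Sum>n. 1 / of_nat (Suc n) powr z)) \<and> w = f s"
  then obtain c f where c: "c < Re s" and hol: "f holomorphic_on {z. c < Re z} - {1}"
    and f: "\<And>z. 1 < Re z \<Longrightarrow> f z = (\<Sum>n. 1 / of_nat (Suc n) powr z)" and w: "w = f s"
    by blast
  \<comment> \<open>Both functions are holomorphic to the right of m, apart from the pole. They are
    compared first where Re z > max m 1, since c, and with it m, may exceed 1.\<close>
  define m where "m = max c 0"
  have "f s = zeta_cont s"
  proof (rule analytic_continuation_open[where f = f and g = zeta_cont])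
    show "open {z. max m 1 < Re z}" by (rule open_halfspace_Re_gt)
    show "open ({z. m < Re z} - {1})" by (rule open_Re_gt_delete)
    have "complex_of_real (\<bar>m\<bar> + 2) \<in> {z. max m 1 < Re z}"
      using abs_ge_self[of m] abs_ge_zero[of m] by (simp del: abs_ge_zero)
    then show "{z. max m 1 < Re z} \<noteq> {}" by blast
    show "connected ({z. m < Re z} - {1})"
      by (intro connected_open_delete open_halfspace_Re_gt convex_connected convex_halfspace_Re_gt) auto
    show "{z. max m 1 < Re z} \<subseteq> {z. m < Re z} - {1}" by auto
    show "f holomorphic_on {z. m < Re z} - {1}"
      by (rule holomorphic_on_subset[OF hol]) (auto simp: m_def)
    show "zeta_cont holomorphic_on {z. m < Re z} - {1}"
      by (rule holomorphic_on_subset[OF zeta_cont_holomorphic]) (auto simp: m_def)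
    show "f z = zeta_cont z" if "z \<in> {z. max m 1 < Re z}" for z
      using that f[of z] zeta_cont_eq_suminf[of z] by auto
    show "s \<in> {z. m < Re z} - {1}" using c assms by (auto simp: m_def)
  qed
  with w show "w = zeta_cont s" by simp
qed

text \<open>The integral does not depend on N while \<open>zeta_partial\<close> converges, so the
  vanishing truncation error leaves an exact equation.\<close>

lemma has_integral_powr_frac:
  assumes s: "Re s > 0" "s \<noteq> 1" and \<theta>: "0 < \<theta>" "\<theta> \<le> 1"
  shows "((\<lambda>x. of_real x powr (s - 1) * of_real (frac (\<theta> / x))) has_integral
          of_real \<theta> / (s - 1) - of_real \<theta> powr s * zeta s / s) {0..1}"
proof -
  let ?I = "integral {0..1} (\<lambda>x. of_real x powr (s - 1) * complex_of_real (frac (\<theta> / x)))"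
  have "(\<lambda>N. ?I - (of_real \<theta> / (s - 1) - of_real \<theta> powr s * zeta_partial N s / s)) \<longlonglongrightarrow>
        ?I - (of_real \<theta> / (s - 1) - of_real \<theta> powr s * zeta_cont s / s)"
    by (intro tendsto_intros zeta_partial_tendsto) (use s in auto)
  moreover have "(\<lambda>N. ?I - (of_real \<theta> / (s - 1) - of_real \<theta> powr s * zeta_partial N s / s)) \<longlonglongrightarrow> 0"
  proof (rule Lim_null_comparison)
    show "\<forall>\<^sub>F N in sequentially.
        norm (?I - (of_real \<theta> / (s - 1) - of_real \<theta> powr s * zeta_partial N s / s))
          \<le> (\<theta> / real N) powr Re s / Re s"
      using eventually_ge_at_top[of 1]
      by eventually_elim (rule powr_frac_integral_approx[OF s \<theta>])
    have "(\<lambda>N. \<theta> / real N) \<longlonglongrightarrow> 0" by (rule lim_const_over_n)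
    then have "(\<lambda>N. (\<theta> / real N) powr Re s / Re s) \<longlonglongrightarrow> 0 powr Re s / Re s"
      using s \<theta> by (intro tendsto_intros) auto
    then show "(\<lambda>N. (\<theta> / real N) powr Re s / Re s) \<longlonglongrightarrow> 0" by simp
  qed
  ultimately have "?I - (of_real \<theta> / (s - 1) - of_real \<theta> powr s * zeta_cont s / s) = 0"
    by (rule LIMSEQ_unique)
  then have "?I = of_real \<theta> / (s - 1) - of_real \<theta> powr s * zeta s / s"
    using s by (simp add: zeta_eq_zeta_cont)
  moreover have "(\<lambda>x. of_real x powr (s - 1) * complex_of_real (frac (\<theta> / x))) integrable_on {0..1}"
    using absolutely_integrable_powr_frac[OF s(1), of \<theta>]
    unfolding absolutely_integrable_on_def by (simp add: integrable_on_Icc_iff_Ioo)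
  ultimately show ?thesis unfolding has_integral_integrable_integral by blast
qed

lemma zeta_of_real_nonzero:
  assumes "0 < \<sigma>" "\<sigma> < 1"
  shows "zeta (of_real \<sigma>) \<noteq> 0"
proof
  let ?s = "complex_of_real \<sigma>"
  let ?g = "\<lambda>x. of_real x powr (?s - 1) * complex_of_real (frac (1 / x))"
  assume "zeta ?s = 0"
  then have "(?g has_integral 1 / (?s - 1)) {0..1}"
    using has_integral_powr_frac[of ?s 1] assms by simp
  also have "1 / (?s - 1) = complex_of_real (1 / (\<sigma> - 1))" by simp
  finally have "((\<lambda>x. Re (?g x)) has_integral Re (complex_of_real (1 / (\<sigma> - 1)))) {0..1}"
    by (rule has_integral_Re)
  moreover have "Re (?g x) \<ge> 0" if "x \<in> {0..1}" for x
  proof -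
    have "of_real x powr (complex_of_real (\<sigma> - 1)) = of_real (x powr (\<sigma> - 1))"
      using that by (intro powr_of_real) auto
    then show ?thesis by (simp add: frac_ge_0)
  qed
  ultimately have "Re (complex_of_real (1 / (\<sigma> - 1))) \<ge> 0"
    by (rule has_integral_nonneg)
  then have "1 / (\<sigma> - 1) \<ge> 0" by simp
  with assms show False by (simp add: divide_simps)
qed

section \<open>Norms and the K-functional on the unit interval\<close>

lemma absolutely_integrable_on_imp_integrable:
  fixes f :: "'a::euclidean_space \<Rightarrow> 'b::euclidean_space"
  assumes "f absolutely_integrable_on S" "S \<in> sets lebesgue"
  shows "integrable (lebesgue_on S) f"
  using assms by (simp add: integrable_restrict_space set_integrable_def)

lemma emeasure_unit_interval [simp]: "emeasure unit_interval_measure {0<..<1} = 1"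
  by (simp add: emeasure_restrict_space)

lemma finite_measure_unit_interval: "finite_measure unit_interval_measure"
  by (rule finite_measureI) (simp add: space_restrict_space)

lemma L2_norm_nonneg [simp]: "L2_norm f \<ge> 0"
  by (simp add: L2_norm_def)

lemma L2_norm_power2: "(L2_norm f)\<^sup>2 = (LINT x|unit_interval_measure. (f x)\<^sup>2)"
  by (simp add: L2_norm_def)

lemma Linf_esssup_nonneg:
  assumes "f \<in> Linf"
  shows "esssup unit_interval_measure (\<lambda>x. ereal \<bar>f x\<bar>) \<ge> 0"
proof -
  \<comment> \<open>Positive total measure matters: over a null space the essential supremum of a
    constant is minus infinity.\<close>
  have "esssup unit_interval_measure (\<lambda>x. 0::ereal) = 0"
    by (intro esssup_const) (simp add: space_restrict_space)
  moreover have "esssup unit_interval_measure (\<lambda>x. 0::ereal) \<le> esssup unit_interval_measure (\<lambda>x. ereal \<bar>f x\<bar>)"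
    by (intro esssup_mono) auto
  ultimately show ?thesis by simp
qed

lemma Linf_norm_nonneg: "f \<in> Linf \<Longrightarrow> Linf_norm f \<ge> 0"
  unfolding Linf_norm_def by (intro real_of_ereal_pos Linf_esssup_nonneg)

text \<open>\<open>real_of_ereal\<close> sends infinite values to 0, so finiteness of the essential
  supremum is established before passing back to reals.\<close>

lemma AE_le_Linf_norm:
  assumes "f \<in> Linf"
  shows "AE x in unit_interval_measure. \<bar>f x\<bar> \<le> Linf_norm f"
proof -
  have "ereal (Linf_norm f) = esssup unit_interval_measure (\<lambda>x. ereal \<bar>f x\<bar>)"
    using assms Linf_esssup_nonneg[OF assms] unfolding Linf_norm_def Linf_def
    by (intro ereal_real') auto
  then show ?thesis
    using esssup_AE[of "\<lambda>x. ereal \<bar>f x\<bar>" unit_interval_measure] by (auto simp flip: ereal_less_eq(3))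
qed

lemma LinfI:
  assumes [measurable]: "f \<in> borel_measurable unit_interval_measure"
    and le: "AE x in unit_interval_measure. \<bar>f x\<bar> \<le> B"
  shows "f \<in> Linf" "Linf_norm f \<le> B"
proof -
  have *: "esssup unit_interval_measure (\<lambda>x. ereal \<bar>f x\<bar>) \<le> ereal B"
    by (rule esssup_I) (use le in auto)
  then show f: "f \<in> Linf"
    by (auto simp: Linf_def le_less_trans[OF *])
  show "Linf_norm f \<le> B"
    unfolding Linf_norm_def using * Linf_esssup_nonneg[OF f]
    by (cases "esssup unit_interval_measure (\<lambda>x. ereal \<bar>f x\<bar>)") auto
qed

lemma K_functional_le:
  assumes "0 \<le> t" "f \<in> L2" "g \<in> Linf" "AE x in unit_interval_measure. \<psi> x = f x + g x"
  shows "K_functional t \<psi> \<le> L2_norm f + t * Linf_norm g"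
  unfolding K_functional_def
proof (rule cInf_lower)
  \<comment> \<open>A real \<open>Inf\<close> is a lower bound only for a set bounded below; 0
    serves because t and both norms are nonnegative.\<close>
  show "bdd_below {L2_norm f + t * Linf_norm g | f g.
     f \<in> L2 \<and> g \<in> Linf \<and> (AE x in unit_interval_measure. \<psi> x = f x + g x)}"
    using assms(1) by (intro bdd_belowI[of _ 0]) (auto intro!: add_nonneg_nonneg mult_nonneg_nonneg Linf_norm_nonneg)
qed (use assms in auto)

lemma indicator_atMost_measurable:
  "indicat_real {..a::real} \<in> borel_measurable unit_interval_measure"
proof -
  have [measurable]: "{..a} \<in> sets lebesgue" by auto
  show ?thesis by (intro measurable_restrict_space1) measurable
qed

text \<open>
  If \<open>\<psi> = f + g\<close>, then \<open>\<psi>\<^sup>2 \<le> 2 f\<^sup>2 + 2 g\<^sup>2\<close>, and the bounded part contributes at most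
  \<open>t\<^sup>2 (Linf_norm g)\<^sup>2\<close> to the integral of \<open>g\<^sup>2\<close> over \<open>(0, t\<^sup>2)\<close>.
\<close>

lemma L2_norm_truncation_le_K_functional:
  assumes t: "0 < t" "t \<le> 1" and \<psi>: "\<psi> \<in> L2"
  shows "L2_norm (\<lambda>x. indicator {..t\<^sup>2} x * \<psi> x) \<le> sqrt 2 * K_functional t \<psi>"
proof -
  let ?U = unit_interval_measure
  let ?A = "{..t\<^sup>2} :: real set"
  interpret finite_measure ?U by (rule finite_measure_unit_interval)
  note [measurable] = indicator_atMost_measurable
  have int_ind: "integrable ?U (indicat_real ?A)"
    by (rule integrable_const_bound[of _ 1]) (auto simp: indicator_def)
  have ind_sq: "(indicat_real ?A x * y)\<^sup>2 = indicat_real ?A x * y\<^sup>2" for x y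
    by (simp add: indicator_def)
  have measure_A: "(LINT x|?U. indicat_real ?A x) \<le> t\<^sup>2"
  proof -
    have "(LINT x|?U. indicat_real ?A x) = (LINT x|lebesgue. indicat_real {0<..<1} x * indicat_real ?A x)"
      by (subst integral_restrict_space) auto
    also have "\<dots> = (LINT x|lebesgue. indicat_real ({0<..<1} \<inter> ?A) x)"
      by (simp add: indicator_inter_arith)
    also have "\<dots> = measure lebesgue ({0<..<1} \<inter> ?A)" by simp
    also have "\<dots> \<le> measure lebesgue {0..t\<^sup>2}"
      by (rule measure_mono_fmeasurable) auto
    finally show ?thesis by simp
  qed
  have "L2_norm (\<lambda>x. indicator ?A x * \<psi> x) / sqrt 2 \<le> L2_norm f + t * Linf_norm g"
    if f: "f \<in> L2" and g: "g \<in> Linf" and eq: "AE x in ?U. \<psi> x = f x + g x" for f g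
  proof -
    define M where "M = Linf_norm g"
    have "M \<ge> 0" using Linf_norm_nonneg[OF g] by (simp add: M_def)
    have [measurable]: "f \<in> borel_measurable ?U" and f_int: "integrable ?U (\<lambda>x. (f x)\<^sup>2)"
      using f by (auto simp: L2_def)
    have [measurable]: "\<psi> \<in> borel_measurable ?U" and \<psi>_int: "integrable ?U (\<lambda>x. (\<psi> x)\<^sup>2)"
      using \<psi> by (auto simp: L2_def)
    have "(L2_norm (\<lambda>x. indicator ?A x * \<psi> x))\<^sup>2 = (LINT x|?U. indicat_real ?A x * (\<psi> x)\<^sup>2)"
      by (simp add: L2_norm_power2 ind_sq)
    also have "\<dots> \<le> (LINT x|?U. 2 * (f x)\<^sup>2 + 2 * M\<^sup>2 * indicat_real ?A x)"
    proof (rule integral_mono_AE)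
      show "integrable ?U (\<lambda>x. indicat_real ?A x * (\<psi> x)\<^sup>2)"
      proof (rule Bochner_Integration.integrable_bound[OF \<psi>_int])
        show "(\<lambda>x. indicat_real ?A x * (\<psi> x)\<^sup>2) \<in> borel_measurable ?U" by measurable
      qed (auto simp: indicator_def)
      show "integrable ?U (\<lambda>x. 2 * (f x)\<^sup>2 + 2 * M\<^sup>2 * indicat_real ?A x)"
        using f_int int_ind by auto
      show "AE x in ?U. indicat_real ?A x * (\<psi> x)\<^sup>2 \<le> 2 * (f x)\<^sup>2 + 2 * M\<^sup>2 * indicat_real ?A x"
        using eq AE_le_Linf_norm[OF g]
      proof eventually_elim
        case (elim x)
        have "(g x)\<^sup>2 \<le> M\<^sup>2" using elim \<open>M \<ge> 0\<close> by (simp add: M_def abs_le_square_iff[symmetric])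
        moreover have "(f x + g x)\<^sup>2 \<le> 2 * (f x)\<^sup>2 + 2 * (g x)\<^sup>2"
          using zero_le_power2[of "f x - g x"] by (simp add: power2_sum power2_diff)
        ultimately show ?case using elim by (auto simp: indicator_def)
      qed
    qed
    also have "\<dots> = 2 * (L2_norm f)\<^sup>2 + 2 * M\<^sup>2 * (LINT x|?U. indicat_real ?A x)"
      using f_int int_ind by (simp add: L2_norm_power2)
    also have "\<dots> \<le> 2 * (L2_norm f)\<^sup>2 + 2 * M\<^sup>2 * t\<^sup>2"
      using measure_A by (intro add_left_mono mult_left_mono) auto
    \<comment> \<open>The cross term is nonnegative, so it may be added to complete the
      square.\<close>
    also have "\<dots> \<le> 2 * (L2_norm f + t * M)\<^sup>2"
      using t \<open>M \<ge> 0\<close> by (simp add: power2_sum power_mult_distrib)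
    also have "\<dots> = (sqrt 2 * (L2_norm f + t * M))\<^sup>2"
      by (simp add: power_mult_distrib)
    finally have "L2_norm (\<lambda>x. indicator ?A x * \<psi> x) \<le> sqrt 2 * (L2_norm f + t * M)"
      by (rule power2_le_imp_le) (use t \<open>M \<ge> 0\<close> in auto)
    then show ?thesis by (simp add: M_def field_simps)
  qed
  \<comment> \<open>The decomposition \<psi> + 0 shows that the infimum is over a nonempty
    set.\<close>
  moreover have "(\<lambda>x. 0) \<in> Linf" by (rule LinfI(1)[of _ 0]) auto
  with \<psi> have "\<exists>f g. f \<in> L2 \<and> g \<in> Linf \<and> (AE x in ?U. \<psi> x = f x + g x)"
    by (intro exI[of _ \<psi>] exI[of _ "\<lambda>x. 0"]) auto
  ultimately have "L2_norm (\<lambda>x. indicator ?A x * \<psi> x) / sqrt 2 \<le> K_functional t \<psi>"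
    unfolding K_functional_def
    by (intro cInf_greatest) auto
  then show ?thesis by (simp add: field_simps)
qed

text \<open>Splitting \<psi> at t^2 bounds the K-functional from above: as \<theta> <= 1, the
  envelope x^((\<theta>-1)/2) is nonincreasing, hence at most t^(\<theta>-1) beyond t^2, and the
  factor t restores t^\<theta>. With the lower bound from truncation, K is squeezed between
  multiples of t^\<theta>, and their ratio gives \<gamma>.\<close>

lemma RevHolder_L2_LinfI:
  assumes \<psi>: "\<psi> \<in> L2" and \<theta>: "0 < \<theta>" "\<theta> \<le> 1" and "0 < a"
    and lower: "\<And>t. 0 < t \<Longrightarrow> t \<le> 1 \<Longrightarrow> a * t powr \<theta> \<le> L2_norm (\<lambda>x. indicator {..t\<^sup>2} x * \<psi> x)"
    and upper: "\<And>t. 0 < t \<Longrightarrow> t \<le> 1 \<Longrightarrow> L2_norm (\<lambda>x. indicator {..t\<^sup>2} x * \<psi> x) \<le> b * t powr \<theta>"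
    and bound: "\<And>x. 0 < x \<Longrightarrow> x < 1 \<Longrightarrow> \<bar>\<psi> x\<bar> \<le> B * x powr ((\<theta> - 1) / 2)"
  shows "\<psi> \<in> RevHolder_L2_Linf"
proof -
  let ?U = unit_interval_measure
  have [measurable]: "\<psi> \<in> borel_measurable ?U" and \<psi>_int: "integrable ?U (\<lambda>x. (\<psi> x)\<^sup>2)"
    using \<psi> by (auto simp: L2_def)
  \<comment> \<open>The envelope at any single point forces B >= 0; 1/2 is an arbitrary
    choice.\<close>
  have "0 \<le> B * (1/2) powr ((\<theta> - 1) / 2)"
    by (rule order_trans[OF _ bound[of "1/2"]]) auto
  then have "B \<ge> 0" by (simp add: zero_le_mult_iff)
  have "a \<le> b" using order_trans[OF lower upper, of 1] by simp
  have K_lower: "a / sqrt 2 * t powr \<theta> \<le> K_functional t \<psi>" if "0 < t" "t \<le> 1" for t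
    using order_trans[OF lower L2_norm_truncation_le_K_functional[OF _ _ \<psi>], OF that that]
    by (simp add: field_simps)
  have K_upper: "K_functional t \<psi> \<le> (b + B) * t powr \<theta>" if t: "0 < t" "t \<le> 1" for t
  proof -
    let ?A = "{..t\<^sup>2} :: real set"
    note [measurable] = indicator_atMost_measurable
    define f where "f = (\<lambda>x. indicator ?A x * \<psi> x)"
    define g where "g = (\<lambda>x. \<psi> x - f x)"
    have [measurable]: "f \<in> borel_measurable ?U" "g \<in> borel_measurable ?U"
      unfolding f_def g_def by measurable
    have "integrable ?U (\<lambda>x. (f x)\<^sup>2)"
    proof (rule Bochner_Integration.integrable_bound[OF \<psi>_int])
      show "(\<lambda>x. (f x)\<^sup>2) \<in> borel_measurable ?U" by measurable
    qed (auto simp: f_def indicator_def)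
    then have f: "f \<in> L2" by (simp add: L2_def)
    have "\<bar>g x\<bar> \<le> B * t powr (\<theta> - 1)" if x: "x \<in> {0<..<1}" for x
    proof (cases "x \<le> t\<^sup>2")
      case False
      then have "\<bar>g x\<bar> \<le> B * x powr ((\<theta> - 1) / 2)"
        using bound[of x] x by (simp add: g_def f_def)
      also have "\<dots> \<le> B * (t\<^sup>2) powr ((\<theta> - 1) / 2)"
        using False \<theta> t \<open>B \<ge> 0\<close> by (intro mult_left_mono powr_mono2') auto
      also have "(t\<^sup>2) powr ((\<theta> - 1) / 2) = t powr (\<theta> - 1)"
      proof -
        have "(t\<^sup>2) powr ((\<theta> - 1) / 2) = (t powr 2) powr ((\<theta> - 1) / 2)"
          using t by simp
        also have "\<dots> = t powr (\<theta> - 1)"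
          unfolding powr_powr by (intro arg_cong2[where f = "(powr)"]) auto
        finally show ?thesis .
      qed
      finally show ?thesis .
    qed (use \<open>B \<ge> 0\<close> in \<open>simp add: g_def f_def\<close>)
    then have "AE x in ?U. \<bar>g x\<bar> \<le> B * t powr (\<theta> - 1)"
      by (intro AE_I2) (simp add: space_restrict_space)
    then have g: "g \<in> Linf" "Linf_norm g \<le> B * t powr (\<theta> - 1)"
      using LinfI[of g] by auto
    have "K_functional t \<psi> \<le> L2_norm f + t * Linf_norm g"
      by (rule K_functional_le) (use t f g in \<open>auto simp: g_def\<close>)
    also have "\<dots> \<le> b * t powr \<theta> + t * (B * t powr (\<theta> - 1))"
      using upper[OF t] g t by (intro add_mono mult_left_mono) (auto simp: f_def)
    also have "\<dots> = (b + B) * t powr \<theta>"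
      using t by (simp add: powr_diff field_simps)
    finally show ?thesis .
  qed
  have "K_functional u \<psi> / K_functional t \<psi> \<le> (b + B) / (a / sqrt 2) * (u / t) powr \<theta>"
    if "0 < u" "u < t" "t \<le> 1" for u t
  proof -
    have "K_functional u \<psi> / K_functional t \<psi> \<le> ((b + B) * u powr \<theta>) / (a / sqrt 2 * t powr \<theta>)"
      using that \<open>0 < a\<close> \<open>a \<le> b\<close> \<open>B \<ge> 0\<close> K_lower[of t] K_upper[of u]
      by (intro frac_le) auto
    also have "\<dots> = (b + B) / (a / sqrt 2) * (u / t) powr \<theta>"
      using that by (simp add: powr_divide)
    finally show ?thesis .
  qed
  moreover have "(b + B) / (a / sqrt 2) > 0" using \<open>0 < a\<close> \<open>a \<le> b\<close> \<open>B \<ge> 0\<close> by simp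
  moreover have "\<not> (AE x in ?U. \<psi> x = 0)"
  proof
    assume "AE x in ?U. \<psi> x = 0"
    \<comment> \<open>At t = 1 the truncation is all of \<psi>, so a vanishing norm contradicts
      \<open>lower\<close>.\<close>
    then have "L2_norm (\<lambda>x. indicator {..1} x * \<psi> x) = 0"
      unfolding L2_norm_def by (subst integral_eq_zero_AE) auto
    then show False using lower[of 1] \<open>0 < a\<close> by simp
  qed
  ultimately show ?thesis
    unfolding RevHolder_L2_Linf_def using \<psi> \<theta> by blast
qed

section \<open>Size of the oscillating power Im (c x^(s-1))\<close>

context
  fixes c s :: complex and \<psi> :: "real \<Rightarrow> real"
  assumes c: "c \<noteq> 0" and s: "1/2 < Re s" "Re s < 1" "Im s \<noteq> 0"
  defines "\<psi> \<equiv> \<lambda>x. Im (c * of_real x powr (s - 1))"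
begin

text \<open>The identity (Im w)^2 = (|w|^2 - Re (w^2)) / 2 turns the square into one real and one
  complex pure power, both with explicit integrals.\<close>

lemma has_integral_Im_powr_square:
  assumes "h \<ge> 0"
  shows "((\<lambda>x. (\<psi> x)\<^sup>2) has_integral
          ((norm c)\<^sup>2 * (h powr (2 * Re s - 1) / (2 * Re s - 1))
            - Re (c\<^sup>2 * (of_real h powr (2 * s - 1) / (2 * s - 1)))) / 2) {0..h}"
proof -
  have eq: "((norm c)\<^sup>2 * x powr (2 * Re s - 1 - 1)
      - Re (c\<^sup>2 * of_real x powr (2 * s - 1 - 1))) / 2 = (\<psi> x)\<^sup>2"
    if "x \<in> {0..h}" for x
  proof -
    let ?w = "c * of_real x powr (s - 1)"
    have "(norm ?w)\<^sup>2 = (norm c)\<^sup>2 * x powr (2 * Re s - 1 - 1)"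
      using that
      by (simp add: norm_mult norm_powr_real_powr power_mult_distrib power2_eq_square flip: powr_add)
    \<comment> \<open>At x = 0 exponents cannot be added, but both sides are 0 since
      \<open>0 powr z = 0\<close>.\<close>
    moreover have "?w\<^sup>2 = c\<^sup>2 * of_real x powr (2 * s - 1 - 1)"
      by (cases "x = 0") (simp_all add: power_mult_distrib power2_eq_square flip: powr_add)
    moreover have "(Im ?w)\<^sup>2 = ((norm ?w)\<^sup>2 - Re (?w\<^sup>2)) / 2"
      unfolding cmod_power2 by (simp add: power2_eq_square)
    ultimately show ?thesis by (simp add: \<psi>_def)
  qed
  have "((\<lambda>x. ((norm c)\<^sup>2 * x powr (2 * Re s - 1 - 1)
      - Re (c\<^sup>2 * of_real x powr (2 * s - 1 - 1))) / 2) has_integral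
          ((norm c)\<^sup>2 * (h powr (2 * Re s - 1) / (2 * Re s - 1))
            - Re (c\<^sup>2 * (of_real h powr (2 * s - 1) / (2 * s - 1)))) / 2) {0..h}"
    using s assms
    by (intro has_integral_divide has_integral_diff has_integral_mult_right has_integral_Re
        has_integral_powr_from_0_real has_integral_powr_from_0_complex) auto
  with eq show ?thesis by (rule has_integral_eq)
qed

text \<open>Both terms of the integral have order h^(2 Re s - 1), so the lower bound comes from
  comparing the coefficients 1/(2 Re s - 1) and 1/|2s-1|. The second term is estimated by its
  modulus, which makes the constants independent of the phase of c.\<close>

lemma integral_Im_powr_square_bounds:
  obtains a where "a > 0"
    "\<And>h. h \<ge> 0 \<Longrightarrow> a * h powr (2 * Re s - 1) \<le> integral {0..h} (\<lambda>x. (\<psi> x)\<^sup>2)"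
    "\<And>h. h \<ge> 0 \<Longrightarrow> integral {0..h} (\<lambda>x. (\<psi> x)\<^sup>2) \<le> (norm c)\<^sup>2 / (2 * Re s - 1) * h powr (2 * Re s - 1)"
proof
  define r where "r = 2 * Re s - 1"
  define n where "n = norm (2 * s - 1)"
  have "r > 0" using s by (simp add: r_def)
  have "r\<^sup>2 < n\<^sup>2"
    using s unfolding n_def cmod_power2 by (simp add: r_def)
  \<comment> \<open>\<open>Im s \<noteq> 0\<close> keeps the oscillating term strictly below the main term.\<close>
  then have "r < n" by (rule power2_less_imp_less) (simp add: n_def)
  then show "(norm c)\<^sup>2 * (1 / r - 1 / n) / 2 > 0"
    using c \<open>r > 0\<close> by (simp add: divide_simps)
  fix h :: real assume h: "h \<ge> 0"
  define z where "z = c\<^sup>2 * (of_real h powr (2 * s - 1) / (2 * s - 1))"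
  have "norm z = (norm c)\<^sup>2 * (h powr r / n)"
    using h unfolding z_def
    by (simp add: norm_mult norm_divide norm_power norm_powr_real_powr r_def n_def)
  then have z: "\<bar>Re z\<bar> \<le> (norm c)\<^sup>2 * (h powr r / n)"
    using abs_Re_le_cmod[of z] by simp
  have I: "integral {0..h} (\<lambda>x. (\<psi> x)\<^sup>2) = ((norm c)\<^sup>2 * (h powr r / r) - Re z) / 2"
    using integral_unique[OF has_integral_Im_powr_square[OF h]] by (simp add: r_def z_def)
  have "(norm c)\<^sup>2 * (1 / r - 1 / n) / 2 * h powr r
      = ((norm c)\<^sup>2 * (h powr r / r) - (norm c)\<^sup>2 * (h powr r / n)) / 2"
    by (simp add: algebra_simps diff_divide_distrib)
  also have "\<dots> \<le> integral {0..h} (\<lambda>x. (\<psi> x)\<^sup>2)"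
    unfolding I by (intro divide_right_mono diff_left_mono abs_le_D1[OF z]) simp
  finally show "(norm c)\<^sup>2 * (1 / r - 1 / n) / 2 * h powr (2 * Re s - 1) \<le> integral {0..h} (\<lambda>x. (\<psi> x)\<^sup>2)"
    by (simp add: r_def)
  have "(norm c)\<^sup>2 * (h powr r / n) \<le> (norm c)\<^sup>2 * (h powr r / r)"
    using \<open>r < n\<close> \<open>r > 0\<close> by (intro mult_left_mono divide_left_mono) auto
  then have "- Re z \<le> (norm c)\<^sup>2 * (h powr r / r)"
    by (rule order_trans[OF abs_le_D2[OF z]])
  moreover have "(y - w) / 2 \<le> y" if "- w \<le> y" for y w :: real
    using that by (simp add: field_simps)
  ultimately have "integral {0..h} (\<lambda>x. (\<psi> x)\<^sup>2) \<le> (norm c)\<^sup>2 * (h powr r / r)"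
    unfolding I by blast
  then show "integral {0..h} (\<lambda>x. (\<psi> x)\<^sup>2) \<le> (norm c)\<^sup>2 / (2 * Re s - 1) * h powr (2 * Re s - 1)"
    by (simp add: r_def)
qed

lemma Im_powr_measurable: "\<psi> \<in> borel_measurable unit_interval_measure"
  unfolding \<psi>_def
  by (intro continuous_imp_measurable_on_sets_lebesgue continuous_intros) auto

lemma Im_powr_in_L2: "\<psi> \<in> L2"
proof -
  have "(\<lambda>x. (\<psi> x)\<^sup>2) integrable_on {0<..<1}"
    using has_integral_Im_powr_square[of 1] by (auto simp: integrable_on_def has_integral_Icc_iff_Ioo)
  then have "(\<lambda>x. (\<psi> x)\<^sup>2) absolutely_integrable_on {0<..<1}"
    by (rule nonnegative_absolutely_integrable_1) auto
  then show ?thesis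
    using Im_powr_measurable by (simp add: L2_def absolutely_integrable_on_imp_integrable)
qed

lemma L2_norm_truncation_Im_powr:
  assumes t: "0 < t" "t \<le> 1"
  shows "(L2_norm (\<lambda>x. indicator {..t\<^sup>2} x * \<psi> x))\<^sup>2 = integral {0..t\<^sup>2} (\<lambda>x. (\<psi> x)\<^sup>2)"
proof -
  let ?f = "\<lambda>x. if x \<in> {0..t\<^sup>2} then (\<psi> x)\<^sup>2 else 0"
  have "t\<^sup>2 \<le> 1" using t by (simp add: power_le_one)
  have f: "(?f has_integral integral {0..t\<^sup>2} (\<lambda>x. (\<psi> x)\<^sup>2)) {0..1}"
    using has_integral_Im_powr_square[of "t\<^sup>2"] \<open>t\<^sup>2 \<le> 1\<close>
    by (subst has_integral_restrict) (auto simp: has_integral_iff)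
  then have f': "(?f has_integral integral {0..t\<^sup>2} (\<lambda>x. (\<psi> x)\<^sup>2)) {0<..<1}"
    by (simp add: has_integral_Icc_iff_Ioo)
  then have "?f absolutely_integrable_on {0<..<1}"
    by (intro nonnegative_absolutely_integrable_1) (auto simp: integrable_on_def)
  then have int: "integrable unit_interval_measure ?f"
    by (rule absolutely_integrable_on_imp_integrable) auto
  have "(L2_norm (\<lambda>x. indicator {..t\<^sup>2} x * \<psi> x))\<^sup>2 = (LINT x|unit_interval_measure. ?f x)"
    unfolding L2_norm_power2
    by (intro Bochner_Integration.integral_cong) (auto simp: space_restrict_space indicator_def)
  also have "\<dots> = integral {0<..<1} ?f"
    by (rule lebesgue_integral_eq_integral[OF int]) auto
  also have "\<dots> = integral {0..t\<^sup>2} (\<lambda>x. (\<psi> x)\<^sup>2)"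
    using f' by (rule integral_unique)
  finally show ?thesis .
qed

lemma Im_powr_in_RevHolder: "\<psi> \<in> RevHolder_L2_Linf"
proof -
  obtain a where a: "a > 0"
    and lower: "\<And>h. h \<ge> 0 \<Longrightarrow> a * h powr (2 * Re s - 1) \<le> integral {0..h} (\<lambda>x. (\<psi> x)\<^sup>2)"
    and upper: "\<And>h. h \<ge> 0 \<Longrightarrow> integral {0..h} (\<lambda>x. (\<psi> x)\<^sup>2)
      \<le> (norm c)\<^sup>2 / (2 * Re s - 1) * h powr (2 * Re s - 1)"
    using integral_Im_powr_square_bounds by blast
  have sq: "(t\<^sup>2) powr r = (t powr r)\<^sup>2" if "t > 0" for t r :: real
    using that by (simp add: power2_eq_square powr_mult)
  show ?thesis
  \<comment> \<open>With \<theta> = 2 Re s - 1 the envelope exponent (\<theta>-1)/2 is Re s - 1, the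
    growth rate of |\<psi>|. The constants a and b are square roots because the integral bounds
    concern squared norms at h = t^2.\<close>
  proof (rule RevHolder_L2_LinfI[where \<theta> = "2 * Re s - 1" and a = "sqrt a"
        and b = "norm c / sqrt (2 * Re s - 1)" and B = "norm c"])
    fix t :: real assume t: "0 < t" "t \<le> 1"
    have "(sqrt a * t powr (2 * Re s - 1))\<^sup>2 \<le> (L2_norm (\<lambda>x. indicator {..t\<^sup>2} x * \<psi> x))\<^sup>2"
      using lower[of "t\<^sup>2"] a t by (simp add: L2_norm_truncation_Im_powr power_mult_distrib sq)
    then show "sqrt a * t powr (2 * Re s - 1) \<le> L2_norm (\<lambda>x. indicator {..t\<^sup>2} x * \<psi> x)"
      by (rule power2_le_imp_le) simp
    have "(L2_norm (\<lambda>x. indicator {..t\<^sup>2} x * \<psi> x))\<^sup>2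
        \<le> (norm c / sqrt (2 * Re s - 1) * t powr (2 * Re s - 1))\<^sup>2"
      using upper[of "t\<^sup>2"] s t
      by (simp add: L2_norm_truncation_Im_powr power_mult_distrib power_divide sq)
    then show "L2_norm (\<lambda>x. indicator {..t\<^sup>2} x * \<psi> x)
        \<le> norm c / sqrt (2 * Re s - 1) * t powr (2 * Re s - 1)"
      by (rule power2_le_imp_le) (use s in simp)
  next
    fix x :: real assume x: "0 < x" "x < 1"
    have "\<bar>\<psi> x\<bar> \<le> norm (c * of_real x powr (s - 1))"
      unfolding \<psi>_def by (rule abs_Im_le_cmod)
    also have "\<dots> = norm c * x powr ((2 * Re s - 1 - 1) / 2)"
      using x by (simp add: norm_mult norm_powr_real_powr diff_divide_distrib)
    finally show "\<bar>\<psi> x\<bar> \<le> norm c * x powr ((2 * Re s - 1 - 1) / 2)" .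
  qed (use s a Im_powr_in_L2 in auto)
qed

end

section \<open>Orthogonality at a zero of zeta, and the conclusion\<close>

text \<open>The factor s - 1 turns the integral into the real number 1/a, which is nonzero; this is
  why \<psi> is an imaginary part and not a real part.\<close>

lemma zeta_zero_orthogonal:
  assumes s: "Re s > 0" "s \<noteq> 1" "zeta s = 0" and "a \<ge> 1"
  shows "(LINT x|lebesgue_on {0<..<1}. Im ((s - 1) * of_real x powr (s - 1)) * frac (1 / (a * x))) = 0"
proof -
  let ?g = "\<lambda>x. of_real x powr (s - 1) * complex_of_real (frac ((1 / a) / x))"
  have int: "integrable unit_interval_measure ?g"
    by (intro absolutely_integrable_on_imp_integrable absolutely_integrable_powr_frac s) auto
  have "(?g has_integral of_real (1 / a) / (s - 1)) {0..1}"
    using has_integral_powr_frac[OF s(1,2), of "1 / a"] s(3) \<open>a \<ge> 1\<close> by simp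
  then have "integral {0<..<1} ?g = of_real (1 / a) / (s - 1)"
    by (intro integral_unique) (simp add: has_integral_Icc_iff_Ioo)
  then have g: "(LINT x|unit_interval_measure. ?g x) = of_real (1 / a) / (s - 1)"
    using lebesgue_integral_eq_integral[OF int] by simp
  have "(LINT x|unit_interval_measure. Im ((s - 1) * of_real x powr (s - 1)) * frac (1 / (a * x)))
      = (LINT x|unit_interval_measure. Im ((s - 1) * ?g x))"
    by (simp add: algebra_simps)
  also have "\<dots> = Im (LINT x|unit_interval_measure. (s - 1) * ?g x)"
    by (intro integral_Im integrable_mult_right int)
  also have "(LINT x|unit_interval_measure. (s - 1) * ?g x) = (s - 1) * (LINT x|unit_interval_measure. ?g x)"
    by (rule integral_mult_right_zero)
  also have "\<dots> = of_real (1 / a)"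
    using s unfolding g by simp
  finally show ?thesis by simp
qed

theorem claim1:
  assumes "\<not> Riemann_Hypothesis"
  shows "\<exists>\<psi> \<in> L2. \<psi> \<in> RevHolder_L2_Linf \<and>
           (\<forall>a::real. a \<ge> 1 \<longrightarrow>
              (LINT x|lebesgue_on {0<..<1}. \<psi> x * frac (1 / (a * x))) = 0)"
proof -
  obtain s where s: "1/2 < Re s" "Re s < 1" "zeta s = 0"
    using assms by (auto simp: Riemann_Hypothesis_def)
  have "s \<noteq> of_real (Re s)"
    using zeta_of_real_nonzero[of "Re s"] s by (metis less_trans half_gt_zero_iff zero_less_one)
  then have "Im s \<noteq> 0" by (simp add: complex_eq_iff)
  have "s \<noteq> 1" using s by auto
  define \<psi> where "\<psi> = (\<lambda>x. Im ((s - 1) * of_real x powr (s - 1)))"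
  have "\<psi> \<in> L2"
    unfolding \<psi>_def using \<open>s \<noteq> 1\<close> s \<open>Im s \<noteq> 0\<close> by (intro Im_powr_in_L2) auto
  moreover have "\<psi> \<in> RevHolder_L2_Linf"
    unfolding \<psi>_def using \<open>s \<noteq> 1\<close> s \<open>Im s \<noteq> 0\<close> by (intro Im_powr_in_RevHolder) auto
  moreover have "(LINT x|lebesgue_on {0<..<1}. \<psi> x * frac (1 / (a * x))) = 0" if "a \<ge> 1" for a
    unfolding \<psi>_def using \<open>s \<noteq> 1\<close> s that by (intro zeta_zero_orthogonal) auto
  ultimately show ?thesis by blast
qed

end
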